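(* Let $D$ be an oriented graph on $n$ vertices with strong diameter $2$. Then $\pi(D)\leq n+1$.
   Context: An oriented graph is a loopless directed graph with no pair of opposite arcs (never both $i\to j$ and $j\to i$). $D$ has strong diameter $2$ if for every ordered pair of distinct vertices $(i,j)$ there is a directed path from $i$ to $j$ of length at most $2$. A configuration is a function $C:V(D)\to\mathbb{N}$ (number of pebbles on each vertex); its size is $|C|=\sum_v C(v)$. A pebbling move along an arc $i\to j$ removes two pebbles from $i$ and adds one pebble to $j$. Given a root $r$, a configuration is $r$-solvable if some sequence (possibly empty) of pebbling moves places at least one pebble on $r$. The pebbling number $\pi(D)$ is the minimum $t$ such that every configuration of size $t$ is $r$-solvable for every choice of root $r\in V(D)$. *)

theory Defs
  imports "Graph_Theory.Arc_Walk" "HOL-Library.Extended_Nat"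
begin

text \<open>
  The locale \<^locale>\<open>digraph\<close> already gives finitely many vertices and arcs, no loops and
  no parallel arcs.
\<close>

locale oriented_graph = digraph +
  assumes no_opposite_arcs: "u \<rightarrow>\<^bsub>G\<^esub> v \<Longrightarrow> \<not> v \<rightarrow>\<^bsub>G\<^esub> u"

definition strong_diameter_2 :: "('a, 'b) pre_digraph \<Rightarrow> bool" where
  "strong_diameter_2 G \<longleftrightarrow>
     (\<forall>i \<in> verts G. \<forall>j \<in> verts G. i \<noteq> j \<longrightarrow>
        (\<exists>p. pre_digraph.apath G i p j \<and> length p \<le> 2))"

text \<open>
  Configurations are total functions on the vertex type. Values outside the vertex set are
  irrelevant: they are not counted in the size, and no arc can carry them into the graph.
\<close>

type_synonym 'a configuration = "'a \<Rightarrow> nat"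

definition config_size :: "('a, 'b) pre_digraph \<Rightarrow> 'a configuration \<Rightarrow> nat" where
  "config_size G C = (\<Sum>v \<in> verts G. C v)"

inductive pebbling_move ::
    "('a, 'b) pre_digraph \<Rightarrow> 'a configuration \<Rightarrow> 'a configuration \<Rightarrow> bool"
  for G :: "('a, 'b) pre_digraph" where
  move: "i \<rightarrow>\<^bsub>G\<^esub> j \<Longrightarrow> 2 \<le> C i \<Longrightarrow>
    pebbling_move G C
      (\<lambda>v. C v - (if v = i then 2 else 0) + (if v = j then 1 else 0))"

definition solvable :: "('a, 'b) pre_digraph \<Rightarrow> 'a \<Rightarrow> 'a configuration \<Rightarrow> bool" where
  "solvable G r C \<longleftrightarrow> (\<exists>C'. (pebbling_move G)\<^sup>*\<^sup>* C C' \<and> 1 \<le> C' r)"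

text \<open>
  The infimum is a minimum whenever some such \<open>t\<close> exists, and is \<open>\<infinity>\<close> otherwise, so a
  finite upper bound on the pebbling number includes the existence of a suitable \<open>t\<close>.
\<close>

definition pebbling_number :: "('a, 'b) pre_digraph \<Rightarrow> enat" where
  "pebbling_number G =
     Inf {enat t | t. \<forall>C. config_size G C = t \<longrightarrow> (\<forall>r \<in> verts G. solvable G r C)}"

end

theory Submission
  imports Defs
begin

text \<open>
  Suppose a configuration \<open>C\<close> of size \<open>n + 1\<close> is not \<open>r\<close>-solvable. Then no vertex carries more than
  three pebbles, so with \<open>B\<close> the vertices carrying at least two pebbles, \<open>A\<close> those carrying three
  and \<open>Z\<close> the empty ones, counting pebbles gives \<open>|Z| < |A| + |B|\<close>. On the other hand \<open>r\<close> is
  empty; every \<open>u \<in> B\<close> has an out-neighbour \<open>g u\<close> with \<open>g u \<rightarrow> r\<close>, and these are empty and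
  distinct; and the paths of length two between two vertices \<open>u, v \<in> A\<close>, and from \<open>u\<close> to \<open>g v\<close>,
  run through empty vertices. Those middle vertices of paths from \<open>u\<close> that differ from \<open>g u\<close> form
  a set \<open>S u\<close>; a vertex lies in at most two of these sets. If neither \<open>S u\<close> nor \<open>S v\<close> has a
  private element, they share one, as \<open>g u \<rightarrow> g v\<close> and \<open>g v \<rightarrow> g u\<close> cannot both hold. Hence the
  sets \<open>S u\<close>, with at most one \<open>u = u0\<close> left out, have distinct representatives: a private element
  or the one shared with \<open>S u0\<close>. So \<open>|Z| \<ge> 1 + |B| + (|A| - 1)\<close>.
\<close>

section \<open>Solvability and paths of length at most two\<close>

lemma pebbling_number_le:
  assumes "\<And>C r. config_size G C = t \<Longrightarrow> r \<in> verts G \<Longrightarrow> solvable G r C"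
  shows "pebbling_number G \<le> enat t"
  unfolding pebbling_number_def using assms by (intro Inf_lower) blast

lemma solvable_if_pebble: "1 \<le> C r \<Longrightarrow> solvable G r C"
  unfolding solvable_def by blast

lemma solvable_if_move: "pebbling_move G C C' \<Longrightarrow> solvable G r C' \<Longrightarrow> solvable G r C"
  unfolding solvable_def by (meson converse_rtranclp_into_rtranclp)

text \<open>Every use of the diameter bound goes through this unpacking of
  \<open>apath\<close>.\<close>

lemma (in wf_digraph) path_le_2_cases:
  assumes "strong_diameter_2 G" "i \<in> verts G" "j \<in> verts G" "i \<noteq> j" "\<not> i \<rightarrow>\<^bsub>G\<^esub> j"
  obtains x where "i \<rightarrow>\<^bsub>G\<^esub> x" "x \<rightarrow>\<^bsub>G\<^esub> j"
proof -
  obtain p where p: "awalk i p j" "length p \<le> 2"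
    using assms(1-4) unfolding strong_diameter_2_def apath_def by blast
  have arc: "tail G e \<rightarrow>\<^bsub>G\<^esub> head G e" if "e \<in> arcs G" for e
    using that by (rule in_arcs_imp_in_arcs_ends)
  consider "p = []" | e where "p = [e]" | e f where "p = [e, f]"
    \<comment> \<open>The borrowed rule splits lists into empty, singleton and at least two
      entries.\<close>
    using p(2) by (cases p rule: remdups_adj.cases) auto
  then show thesis
  proof cases
    case 1
    with p(1) assms(4) show thesis by (simp add: awalk_Nil_iff)
  next
    case (2 e)
    with p(1) arc[of e] assms(5) show thesis by (auto simp: awalk_Cons_iff awalk_Nil_iff)
  next
    case (3 e f)
    with p(1) have "e \<in> arcs G" "f \<in> arcs G" "tail G e = i" "head G e = tail G f" "head G f = j"
      by (auto simp: awalk_Cons_iff awalk_Nil_iff)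
    with arc[of e] arc[of f] that show thesis by auto
  qed
qed

section \<open>Local constraints on unsolvable configurations\<close>

context oriented_graph
begin

text \<open>A solution after the move would extend to one before it. Most constraints below follow
  by making one move and applying an earlier constraint to the resulting \<open>C'\<close>.\<close>

lemma unsolvable_move:
  assumes "\<not> solvable G r C" "i \<rightarrow>\<^bsub>G\<^esub> j" "2 \<le> C i"
  obtains C' where "\<not> solvable G r C'" "C' i = C i - 2" "C' j = C j + 1"
    "\<And>v. v \<noteq> i \<Longrightarrow> v \<noteq> j \<Longrightarrow> C' v = C v"
proof -
  let ?C = "\<lambda>v. C v - (if v = i then 2 else 0) + (if v = j then 1 else 0)"
  have "i \<noteq> j" using assms(2) no_opposite_arcs by blast
  moreover have "pebbling_move G C ?C"
    using assms(2,3) by (rule pebbling_move.move)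
  then have "\<not> solvable G r ?C" using assms(1) by (auto dest: solvable_if_move)
  ultimately show thesis by (intro that[of ?C]) auto
qed

lemma unsolvable_root: "\<not> solvable G r C \<Longrightarrow> C r = 0"
  using solvable_if_pebble[of C r G] by linarith

lemma unsolvable_in_neighbour:
  assumes "\<not> solvable G r C" "v \<rightarrow>\<^bsub>G\<^esub> r"
  shows "C v \<le> 1"
proof (rule ccontr)
  assume "\<not> ?thesis"
  then have "2 \<le> C v" by simp
  from unsolvable_move[OF assms this] unsolvable_root show False
    by (metis add_is_0 one_neq_zero)
qed

text \<open>A pebble on \<open>w\<close> would be joined by a second one from \<open>u\<close>, and
  \<open>w\<close> is an in-neighbour of \<open>r\<close>.\<close>

lemma unsolvable_middle_empty:
  assumes "\<not> solvable G r C" "2 \<le> C u" "u \<rightarrow>\<^bsub>G\<^esub> w" "w \<rightarrow>\<^bsub>G\<^esub> r"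
  shows "C w = 0"
proof -
  obtain C' where "\<not> solvable G r C'" "C' w = C w + 1"
    using unsolvable_move[OF assms(1,3,2)] by metis
  with unsolvable_in_neighbour[of r C' w] assms(4) show ?thesis by simp
qed

lemma unsolvable_middle_unique:
  assumes "\<not> solvable G r C" "2 \<le> C u" "2 \<le> C v" "u \<rightarrow>\<^bsub>G\<^esub> w" "v \<rightarrow>\<^bsub>G\<^esub> w" "w \<rightarrow>\<^bsub>G\<^esub> r"
  shows "u = v"
proof (rule ccontr)
  assume "u \<noteq> v"
  moreover have "v \<noteq> w" using assms(5) no_opposite_arcs by blast
  moreover obtain C' where "\<not> solvable G r C'" "C' w = C w + 1"
    "\<And>x. x \<noteq> u \<Longrightarrow> x \<noteq> w \<Longrightarrow> C' x = C x"
    using unsolvable_move[OF assms(1,4,2)] by metis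
  ultimately show False
    using unsolvable_middle_empty[of r C' v w] assms(3,5,6) by simp
qed

text \<open>With four pebbles on \<open>v\<close>, one move towards \<open>r\<close> leaves two on
  \<open>v\<close> and makes the middle vertex \<open>w\<close> nonempty.\<close>

lemma unsolvable_le_3:
  assumes "strong_diameter_2 G" "r \<in> verts G" "\<not> solvable G r C" "v \<in> verts G"
  shows "C v \<le> 3"
proof (rule ccontr)
  assume "\<not> ?thesis"
  then have v: "4 \<le> C v" and "2 \<le> C v" by simp_all
  then have "v \<noteq> r" "\<not> v \<rightarrow>\<^bsub>G\<^esub> r"
    using unsolvable_root[OF assms(3)] unsolvable_in_neighbour[OF assms(3), of v] by auto
  then obtain w where w: "v \<rightarrow>\<^bsub>G\<^esub> w" "w \<rightarrow>\<^bsub>G\<^esub> r"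
    using path_le_2_cases assms by metis
  obtain C' where "\<not> solvable G r C'" "C' w = C w + 1" "C' v = C v - 2"
    using unsolvable_move[OF assms(3) w(1) \<open>2 \<le> C v\<close>] by metis
  moreover from this v have "2 \<le> C' v" by linarith
  ultimately show False using unsolvable_middle_empty[of r C' v w] w by simp
qed

text \<open>The move along such an arc would bring \<open>v\<close> to four pebbles.\<close>

lemma unsolvable_no_arc_to_3:
  assumes "strong_diameter_2 G" "r \<in> verts G" "\<not> solvable G r C" "2 \<le> C u" "C v = 3"
  shows "\<not> u \<rightarrow>\<^bsub>G\<^esub> v"
proof
  assume uv: "u \<rightarrow>\<^bsub>G\<^esub> v"
  then obtain C' where "\<not> solvable G r C'" "C' v = C v + 1"
    using unsolvable_move[OF assms(3) _ assms(4)] by metis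
  with unsolvable_le_3[OF assms(1,2), of C' v] uv assms(5) show False by auto
qed

lemma unsolvable_middle_to_3_empty:
  assumes "strong_diameter_2 G" "r \<in> verts G" "\<not> solvable G r C" "2 \<le> C u" "C v = 3"
    and "u \<noteq> v" "u \<rightarrow>\<^bsub>G\<^esub> x" "x \<rightarrow>\<^bsub>G\<^esub> v"
  shows "C x = 0"
proof -
  have "v \<noteq> x" using assms(8) no_opposite_arcs by blast
  moreover obtain C' where "\<not> solvable G r C'" "C' x = C x + 1"
    "\<And>y. y \<noteq> u \<Longrightarrow> y \<noteq> x \<Longrightarrow> C' y = C y"
    using unsolvable_move[OF assms(3,7,4)] by metis
  ultimately show ?thesis
    using unsolvable_no_arc_to_3[OF assms(1,2), of C' x v] assms(5,6,8) by force
qed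

text \<open>If \<open>u\<close> and \<open>u'\<close> differ, the move from \<open>u\<close> makes
  \<open>x\<close> nonempty while \<open>u'\<close> and \<open>v\<close> keep their pebbles.\<close>

lemma unsolvable_middle_to_3_unique:
  assumes "strong_diameter_2 G" "r \<in> verts G" "\<not> solvable G r C"
    and "2 \<le> C u" "2 \<le> C u'" "C v = 3"
    and "u \<rightarrow>\<^bsub>G\<^esub> x" "u' \<rightarrow>\<^bsub>G\<^esub> x" "x \<rightarrow>\<^bsub>G\<^esub> v"
  shows "u = u'"
proof (rule ccontr)
  assume "u \<noteq> u'"
  moreover have "v \<noteq> x" "u' \<noteq> x" "u \<noteq> v" "u' \<noteq> v"
    using assms(7-9) no_opposite_arcs by metis+
  moreover obtain C' where "\<not> solvable G r C'" "C' x = C x + 1"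
    "\<And>y. y \<noteq> u \<Longrightarrow> y \<noteq> x \<Longrightarrow> C' y = C y"
    using unsolvable_move[OF assms(3,7,4)] by metis
  ultimately show False
    using unsolvable_middle_to_3_empty[OF assms(1,2), of C' u' v x] assms(5,6,8,9) by simp
qed

text \<open>If \<open>s\<close> were nonempty, the move from \<open>u\<close> would give it two
  pebbles; then \<open>s\<close> and \<open>v\<close> could each send one to \<open>y\<close>, and
  \<open>y\<close> one to \<open>r\<close>.\<close>

lemma unsolvable_middle_to_middle_empty:
  assumes "\<not> solvable G r C" "2 \<le> C u" "2 \<le> C v" "u \<noteq> v" "s \<noteq> v"
    and "u \<rightarrow>\<^bsub>G\<^esub> s" "s \<rightarrow>\<^bsub>G\<^esub> y" "v \<rightarrow>\<^bsub>G\<^esub> y" "y \<rightarrow>\<^bsub>G\<^esub> r"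
  shows "C s = 0"
proof -
  obtain C' where "\<not> solvable G r C'" "C' s = C s + 1"
    "\<And>x. x \<noteq> u \<Longrightarrow> x \<noteq> s \<Longrightarrow> C' x = C x"
    using unsolvable_move[OF assms(1,6,2)] by metis
  then show ?thesis
    using unsolvable_middle_unique[of r C' s v y] assms by force
qed

lemma unsolvable_middle_to_middle_unique:
  assumes "\<not> solvable G r C" "2 \<le> C u" "2 \<le> C u'" "2 \<le> C v" "u \<noteq> v" "u' \<noteq> v" "s \<noteq> v"
    and "u \<rightarrow>\<^bsub>G\<^esub> s" "u' \<rightarrow>\<^bsub>G\<^esub> s" "s \<rightarrow>\<^bsub>G\<^esub> y" "v \<rightarrow>\<^bsub>G\<^esub> y" "y \<rightarrow>\<^bsub>G\<^esub> r"
  shows "u = u'"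
proof (rule ccontr)
  assume "u \<noteq> u'"
  moreover have "u' \<noteq> s" using assms(9) no_opposite_arcs by blast
  moreover obtain C' where "\<not> solvable G r C'" "C' s = C s + 1"
    "\<And>x. x \<noteq> u \<Longrightarrow> x \<noteq> s \<Longrightarrow> C' x = C x"
    using unsolvable_move[OF assms(1,8,2)] by metis
  ultimately show False
    using unsolvable_middle_to_middle_empty[of r C' u' v s y] assms by force
qed

section \<open>Counting the empty vertices in two ways\<close>

lemma solvable_of_size:
  assumes diam: "strong_diameter_2 G" and r: "r \<in> verts G"
    and size: "config_size G C = card (verts G) + 1"
  shows "solvable G r C"
proof (rule ccontr)
  assume uns: "\<not> solvable G r C"
  define A where "A = {v \<in> verts G. C v = 3}"
  define B where "B = {v \<in> verts G. 2 \<le> C v}"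
  define Z where "Z = {v \<in> verts G. C v = 0}"
  have fin: "finite A" "finite B" "finite Z" by (simp_all add: A_def B_def Z_def)
  have "A \<subseteq> B" by (auto simp: A_def B_def)
  have "r \<in> Z" using r unsolvable_root[OF uns] by (simp add: Z_def)

  have upper: "card Z < card A + card B"
  proof -
    let ?i = "\<lambda>P. if P then 1 else (0 :: nat)"
    \<comment> \<open>Only the values 0, 1, 2, 3 of \<open>C v\<close> occur, and each satisfies the
      identity.\<close>
    have "C v + ?i (C v = 0) = 1 + ?i (2 \<le> C v) + ?i (C v = 3)" if "v \<in> verts G" for v
      using unsolvable_le_3[OF diam r uns that] by auto
    then have "(\<Sum>v\<in>verts G. C v + ?i (C v = 0))
        = (\<Sum>v\<in>verts G. 1 + ?i (2 \<le> C v) + ?i (C v = 3))"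
      by (intro sum.cong) auto
    then have "config_size G C + card Z = card (verts G) + card B + card A"
      unfolding sum.distrib
      by (simp add: config_size_def A_def B_def Z_def flip: sum.inter_filter)
    with size show ?thesis by simp
  qed

  have "\<exists>w. u \<rightarrow>\<^bsub>G\<^esub> w \<and> w \<rightarrow>\<^bsub>G\<^esub> r" if "u \<in> B" for u
  proof -
    from that have "u \<in> verts G" "u \<noteq> r" "\<not> u \<rightarrow>\<^bsub>G\<^esub> r"
      using unsolvable_root[OF uns] unsolvable_in_neighbour[OF uns, of u] by (auto simp: B_def)
    then show ?thesis using path_le_2_cases[OF diam _ r] by metis
  qed
  then obtain g where g: "u \<rightarrow>\<^bsub>G\<^esub> g u" "g u \<rightarrow>\<^bsub>G\<^esub> r" if "u \<in> B" for u
    by metis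
  have gZ: "g u \<in> Z" if "u \<in> B" for u
    using unsolvable_middle_empty[OF uns _ g[OF that]] g[OF that] that
    by (auto simp: B_def Z_def dest: adj_in_verts)
  have to_root_unique: "u = v" if "u \<in> B" "v \<in> B" "u \<rightarrow>\<^bsub>G\<^esub> w" "v \<rightarrow>\<^bsub>G\<^esub> w" "w \<rightarrow>\<^bsub>G\<^esub> r" for u v w
    using unsolvable_middle_unique[OF uns] that by (auto simp: B_def)
  have inj_g: "inj_on g B"
    using to_root_unique g by (metis inj_onI)

  \<comment> \<open>The alternatives are the possible ends of a path from \<open>u\<close> through
    \<open>s\<close>: the root, a vertex of \<open>A\<close>, or some \<open>g v\<close>. Only the
    last must exclude \<open>v = u\<close> explicitly, since \<open>u \<rightarrow> s\<close>
    forbids \<open>s \<rightarrow> u\<close>.\<close>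
  define S where "S u = {s \<in> Z. u \<rightarrow>\<^bsub>G\<^esub> s \<and> s \<noteq> g u \<and>
    (s \<rightarrow>\<^bsub>G\<^esub> r \<or> (\<exists>v\<in>A. s \<rightarrow>\<^bsub>G\<^esub> v) \<or> (\<exists>v\<in>A - {u}. s \<rightarrow>\<^bsub>G\<^esub> g v))}" for u
  have g_unique: "u = u'"
    if "s \<in> Z" "u \<in> A" "u' \<in> A" "v \<in> A" "u \<noteq> v" "u' \<noteq> v" "u \<rightarrow>\<^bsub>G\<^esub> s" "u' \<rightarrow>\<^bsub>G\<^esub> s" "s \<rightarrow>\<^bsub>G\<^esub> g v"
    for u u' v s
  proof -
    have "s \<noteq> v" "2 \<le> C u" "2 \<le> C u'" "2 \<le> C v" using that by (auto simp: A_def Z_def)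
    then show ?thesis
      using unsolvable_middle_to_middle_unique[OF uns] g[of v] that \<open>A \<subseteq> B\<close> by blast
  qed
  have to_A_unique: "u = u'" if "u \<in> A" "u' \<in> A" "v \<in> A" "u \<rightarrow>\<^bsub>G\<^esub> s" "u' \<rightarrow>\<^bsub>G\<^esub> s" "s \<rightarrow>\<^bsub>G\<^esub> v" for u u' v s
    using unsolvable_middle_to_3_unique[OF diam r uns, of u u' v s] that by (simp add: A_def)
  \<comment> \<open>Otherwise \<open>u\<close> and \<open>u'\<close>, both different from
    \<open>v\<close>, would reach \<open>g v\<close> through the same \<open>s\<close>.\<close>
  have S_shared: "v = u'"
    if "s \<in> S u" "s \<in> S u'" "u \<in> A" "u' \<in> A" "u \<noteq> u'" "v \<in> A" "v \<noteq> u" "s \<rightarrow>\<^bsub>G\<^esub> g v" for s u u' v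
    using g_unique[of s u u' v] that by (auto simp: S_def)
  \<comment> \<open>A shared \<open>s\<close> has no arc to \<open>r\<close> or into
    \<open>A\<close>, by the uniqueness facts, so only the third alternative in \<open>S u\<close>
    remains.\<close>
  have S_shared_to_g: "s \<rightarrow>\<^bsub>G\<^esub> g u'"
    if s: "s \<in> S u" "s \<in> S u'" "u \<in> A" "u' \<in> A" "u \<noteq> u'" for s u u'
  proof -
    have "u \<rightarrow>\<^bsub>G\<^esub> s" "u' \<rightarrow>\<^bsub>G\<^esub> s" using that by (auto simp: S_def)
    then have "\<not> s \<rightarrow>\<^bsub>G\<^esub> r" "\<not> (\<exists>v\<in>A. s \<rightarrow>\<^bsub>G\<^esub> v)"
      using to_root_unique[of u u' s] to_A_unique[of u u' _ s] that \<open>A \<subseteq> B\<close> by auto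
    then obtain v where "v \<in> A" "v \<noteq> u" "s \<rightarrow>\<^bsub>G\<^esub> g v" using s(1) by (auto simp: S_def)
    with S_shared[OF s] show ?thesis by blast
  qed

  \<comment> \<open>The middle vertex of a path from \<open>u\<close> to \<open>v\<close> is
    \<open>g u\<close> or lies in \<open>S u\<close>; in the latter case \<open>to_A_unique\<close>
    makes it private to \<open>u\<close>.\<close>
  have middle_A: "g u \<rightarrow>\<^bsub>G\<^esub> v \<or> (\<exists>s\<in>S u. \<forall>w\<in>A. s \<in> S w \<longrightarrow> w = u)"
    if uvA: "u \<in> A" "v \<in> A" "u \<noteq> v" for u v
  proof -
    have uv: "u \<in> verts G" "v \<in> verts G" "2 \<le> C u" "C v = 3" using that by (auto simp: A_def)
    then obtain x where x: "u \<rightarrow>\<^bsub>G\<^esub> x" "x \<rightarrow>\<^bsub>G\<^esub> v"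
      using path_le_2_cases[OF diam uv(1,2) uvA(3)] unsolvable_no_arc_to_3[OF diam r uns uv(3,4)]
      by metis
    then have "x \<in> Z"
      using unsolvable_middle_to_3_empty[OF diam r uns uv(3,4) uvA(3)]
      by (auto simp: Z_def dest: adj_in_verts)
    with x uvA have "x = g u \<or> x \<in> S u" by (auto simp: S_def)
    moreover have "w = u" if "w \<in> A" "x \<in> S w" for w
      using to_A_unique[of w u v x] that x uvA by (auto simp: S_def)
    ultimately show ?thesis using x by blast
  qed
  \<comment> \<open>The arc \<open>g v \<rightarrow> u\<close> excludes a direct arc from
    \<open>u\<close> to \<open>g v\<close>, which forces a path of length two.\<close>
  have middle_g: "g u \<rightarrow>\<^bsub>G\<^esub> g v \<or> (\<exists>s\<in>S u. s \<rightarrow>\<^bsub>G\<^esub> g v)"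
    if "u \<in> A" "v \<in> A" "u \<noteq> v" "g v \<rightarrow>\<^bsub>G\<^esub> u" for u v
  proof -
    have uv: "2 \<le> C u" "2 \<le> C v" "C v = 3" "u \<in> verts G" "v \<in> B"
      using that by (auto simp: A_def B_def)
    have "g v \<in> verts G" using gZ[OF \<open>v \<in> B\<close>] by (simp add: Z_def)
    moreover have "u \<noteq> g v" "\<not> u \<rightarrow>\<^bsub>G\<^esub> g v" using no_opposite_arcs that(4) by metis+
    ultimately obtain s where s: "u \<rightarrow>\<^bsub>G\<^esub> s" "s \<rightarrow>\<^bsub>G\<^esub> g v"
      using path_le_2_cases[OF diam uv(4)] by metis
    have "s \<noteq> v" using s(1) unsolvable_no_arc_to_3[OF diam r uns uv(1,3)] by blast
    then have "s \<in> Z"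
      using unsolvable_middle_to_middle_empty[OF uns uv(1,2) that(3) _ s g[OF uv(5)]] s
      by (auto simp: Z_def dest: adj_in_verts)
    with s that show ?thesis by (auto simp: S_def)
  qed

  have "\<exists>u0. \<forall>u\<in>A - {u0}. \<exists>s\<in>S u. \<forall>v\<in>A. s \<in> S v \<longrightarrow> v = u \<or> v = u0"
  proof -
    \<comment> \<open>\<open>U\<close> collects the vertices without a private element;
      \<open>u0\<close> will be any one of them.\<close>
    define U where "U = {u \<in> A. \<not> (\<exists>s\<in>S u. \<forall>v\<in>A. s \<in> S v \<longrightarrow> v = u)}"
    have shared: "\<exists>s\<in>S u. \<forall>w\<in>A. s \<in> S w \<longrightarrow> w = u \<or> w = v"
      if uv: "u \<in> U" "v \<in> U" "u \<noteq> v" for u v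
    proof -
      have A: "u \<in> A" "v \<in> A" using uv by (auto simp: U_def)
      have to_g: "\<exists>s\<in>S u. s \<in> S v"
        if u: "u \<in> U" and v: "v \<in> U" "u \<noteq> v" and no_arc: "\<not> g u \<rightarrow>\<^bsub>G\<^esub> g v" for u v
      proof -
        have A: "u \<in> A" "v \<in> A" using u v by (auto simp: U_def)
        \<comment> \<open>As \<open>v\<close> has no private element, \<open>middle_A\<close> leaves
          only this arc. The \<open>s\<close> then found by \<open>middle_g\<close> is not private
          to \<open>u\<close>, and \<open>S_shared\<close> identifies its other owner as
          \<open>v\<close>.\<close>
        have "g v \<rightarrow>\<^bsub>G\<^esub> u" using middle_A[of v u] A v by (auto simp: U_def)
        then obtain s where s: "s \<in> S u" "s \<rightarrow>\<^bsub>G\<^esub> g v" using middle_g A v(2) no_arc by blast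
        obtain w where "w \<in> A" "s \<in> S w" "w \<noteq> u" using u s(1) by (auto simp: U_def)
        with S_shared[of s u w v] s A v(2) show ?thesis by blast
      qed
      \<comment> \<open>The arcs between \<open>g u\<close> and \<open>g v\<close> cannot both
        exist, so \<open>to_g\<close> applies in at least one order.\<close>
      obtain s where s: "s \<in> S u" "s \<in> S v"
        using to_g[OF uv] to_g[OF uv(2,1)] uv(3) no_opposite_arcs by metis
      moreover have "w = u \<or> w = v" if w: "w \<in> A" "s \<in> S w" for w
        using S_shared[of s u w v] S_shared_to_g[OF s A uv(3)] s A uv(3) w by blast
      ultimately show ?thesis by blast
    qed
    show ?thesis
    proof (cases "U = {}")
      case True
      then show ?thesis unfolding U_def by blast
    next
      case False
      then obtain u0 where "u0 \<in> U" by blast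
      then have "\<exists>s\<in>S u. \<forall>v\<in>A. s \<in> S v \<longrightarrow> v = u \<or> v = u0" if "u \<in> A - {u0}" for u
        using shared[of u u0] that unfolding U_def by (cases "u \<in> U") (auto simp: U_def)
      then show ?thesis by blast
    qed
  qed
  then obtain u0 h where h: "h u \<in> S u" "\<forall>v\<in>A. h u \<in> S v \<longrightarrow> v = u \<or> v = u0"
    if "u \<in> A - {u0}" for u
    by metis
  let ?A = "A - {u0}"
  \<comment> \<open>If \<open>h u = h v\<close>, then \<open>h u\<close> lies in \<open>S v\<close>,
    so \<open>v\<close> is \<open>u\<close> or \<open>u0\<close>, and \<open>u0\<close> has been
    removed.\<close>
  have inj_h: "inj_on h ?A"
    using h by (metis DiffE inj_onI singletonI)

  have hS: "h u \<in> Z" "u \<rightarrow>\<^bsub>G\<^esub> h u" "h u \<noteq> g u" "u \<in> B" "2 \<le> C u" if "u \<in> ?A" for u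
    using h(1)[OF that] that by (auto simp: S_def A_def B_def)
  have "r \<noteq> g u" if "u \<in> B" for u
    using g[OF that] no_opposite_arcs by metis
  moreover have "r \<noteq> h u" if "u \<in> ?A" for u
    using hS[OF that] unsolvable_in_neighbour[OF uns, of u] by auto
  \<comment> \<open>Equality would give \<open>u\<close> and \<open>v\<close> a common out-neighbour
    with an arc to \<open>r\<close>, hence \<open>u = v\<close>, against
    \<open>h u \<noteq> g u\<close>.\<close>
  moreover have "g v \<noteq> h u" if "u \<in> ?A" "v \<in> B" for u v
    using hS[OF that(1)] to_root_unique[of u v "g v"] g[OF that(2)] that(2) by metis
  ultimately have disj: "r \<notin> g ` B \<union> h ` ?A" "g ` B \<inter> h ` ?A = {}" by auto
  have "insert r (g ` B \<union> h ` ?A) \<subseteq> Z"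
    using \<open>r \<in> Z\<close> gZ hS by auto
  then have "card (insert r (g ` B \<union> h ` ?A)) \<le> card Z"
    using fin by (intro card_mono)
  moreover have "card (insert r (g ` B \<union> h ` ?A)) = 1 + (card B + card ?A)"
    using disj fin by (simp add: card_Un_disjoint card_image inj_g inj_h)
  moreover have "card A \<le> 1 + card ?A"
    by (simp add: card_Diff_singleton_if) linarith
  ultimately show False using upper by simp
qed

end

theorem theorem2:
  fixes D :: "('a, 'b) pre_digraph" and n :: nat
  assumes "oriented_graph D"
    and "card (verts D) = n"
    and "strong_diameter_2 D"
  shows "pebbling_number D \<le> enat (n + 1)"
  using oriented_graph.solvable_of_size[OF assms(1,3)] assms(2)
  by (intro pebbling_number_le) blast

end
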